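(* Let $S$ be the set of Twyst-off positions $(s_1,\dots,s_n)$ (including the empty position) for which $1\le s_i\le 2$ for all $i$ and every interior sequence of $1$'s has even length, and for an integer $k\ge 0$ let $S_k$ be the set of positions $(s_1,\dots,s_n)\in S$ with $\sum_i s_i=k$. If $k\equiv 0 \pmod 3$, then all positions in $S_k$ are $P$ positions, and if $k\not\equiv 0\pmod 3$, then all positions in $S_k$ are $N$ positions.
   Context: Twyst-off is a two-player impartial game (players alternate; normal play: the last player to move legally wins). A position is a finite ordered sequence $(s_1,\dots,s_n)$ of stacks of tiles, with stack sizes nonnegative integers. Positions are subject to the identifications: an end stack of size $0$ is deleted; an interior stack of size $0$ is deleted and its two neighbors are combined, i.e. $(\dots,x,0,y,\dots)=(\dots,x+y,\dots)$. Thus every position equals a (possibly empty) sequence of positive integers. From a sequence of positive integers, a move is one of: (i) remove $k\ge 1$ tiles from the first or from the last stack; (ii) remove the same number $k\ge 1$ of tiles from two consecutive stacks; after which the identifications are applied. A position is $P$ if the previous (second) player can force a win, equivalently if none of its options (positions reachable in one move) is $P$; it is $N$ if the next (first) player can force a win, equivalently if some option is $P$. An interior sequence of $1$'s in $(s_1,\dots,s_n)$ means a maximal block of consecutive entries equal to $1$ containing neither the first nor the last entry (i.e. a block of $1$'s immediately preceded and immediately followed by an entry equal to $2$). *)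

theory Defs
  imports Main
begin

definition position :: "nat list \<Rightarrow> bool" where
  "position p \<longleftrightarrow> (\<forall>s\<in>set p. 0 < s)"

text \<open>
  The identifications, oriented as reductions on arbitrary stack sequences. The reduction is
  terminating and confluent, so every sequence represents exactly one position
  (lemma \<open>ex1_position\<close> below).
\<close>

inductive identify :: "nat list \<Rightarrow> nat list \<Rightarrow> bool" where
  delete_first: "identify (0 # xs) xs"
| delete_last: "identify (xs @ [0]) xs"
| combine: "identify (xs @ x # 0 # y # ys) (xs @ (x + y) # ys)"

inductive remove_tiles :: "nat list \<Rightarrow> nat list \<Rightarrow> bool" where
  from_first: "1 \<le> k \<Longrightarrow> k \<le> s \<Longrightarrow> remove_tiles (s # xs) ((s - k) # xs)"
| from_last: "1 \<le> k \<Longrightarrow> k \<le> s \<Longrightarrow> remove_tiles (xs @ [s]) (xs @ [s - k])"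
| from_consecutive: "1 \<le> k \<Longrightarrow> k \<le> s \<Longrightarrow> k \<le> t \<Longrightarrow>
    remove_tiles (xs @ s # t # ys) (xs @ (s - k) # (t - k) # ys)"

definition move :: "nat list \<Rightarrow> nat list \<Rightarrow> bool" where
  "move p q \<longleftrightarrow> position p \<and> (\<exists>r. remove_tiles p r \<and> identify\<^sup>*\<^sup>* r q \<and> position q)"

text \<open>
  Outcome classes under normal play: \<open>P_position\<close> means that the previous player can force a win,
  \<open>N_position\<close> that the next player can. The least fixed point counts only wins that are
  reached after finitely many moves; a player without a move loses.
\<close>

inductive P_position :: "nat list \<Rightarrow> bool" and N_position :: "nat list \<Rightarrow> bool" where
  P: "position p \<Longrightarrow> (\<forall>q. move p q \<longrightarrow> N_position q) \<Longrightarrow> P_position p"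
| N: "move p q \<Longrightarrow> P_position q \<Longrightarrow> N_position p"

text \<open>
  \<open>interior_ones p m\<close>: some maximal block of consecutive ones in \<open>p\<close>, containing neither the first
  nor the last entry of \<open>p\<close>, has length \<open>m\<close>.
\<close>

definition interior_ones :: "nat list \<Rightarrow> nat \<Rightarrow> bool" where
  "interior_ones p m \<longleftrightarrow> 1 \<le> m \<and>
     (\<exists>xs ys. p = xs @ replicate m 1 @ ys \<and> xs \<noteq> [] \<and> ys \<noteq> [] \<and> last xs \<noteq> 1 \<and> hd ys \<noteq> 1)"

definition S :: "nat list set" where
  "S = {p. (\<forall>s\<in>set p. 1 \<le> s \<and> s \<le> 2) \<and> (\<forall>m. interior_ones p m \<longrightarrow> even m)}"

definition S_sum :: "nat \<Rightarrow> nat list set" where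
  "S_sum k = {p \<in> S. sum_list p = k}"


subsection \<open>Well-definedness of the identifications\<close>

lemma identify_length: "identify xs ys \<Longrightarrow> length ys < length xs"
  by (induction rule: identify.induct) auto

lemma identify_progress:
  assumes "\<not> position xs"
  shows "\<exists>ys. identify xs ys"
proof -
  from assms have "0 \<in> set xs" by (auto simp: position_def)
  then obtain us vs where xs: "xs = us @ 0 # vs" by (meson split_list)
  show ?thesis
  proof (cases "us = [] \<or> vs = []")
    case True
    then show ?thesis using xs delete_first delete_last by fastforce
  next
    case False
    then obtain us' x y vs' where "us = us' @ [x]" "vs = y # vs'"
      by (metis neq_Nil_conv rev_exhaust)
    then show ?thesis using xs combine[of us' x y vs'] by auto
  qed
qed

lemma ex_position: "\<exists>p. identify\<^sup>*\<^sup>* xs p \<and> position p"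
proof (induction xs rule: measure_induct_rule[of length])
  case (less xs)
  show ?case
  proof (cases "position xs")
    case False
    then obtain ys where "identify xs ys" using identify_progress by blast
    then show ?thesis using less[OF identify_length]
      by (meson converse_rtranclp_into_rtranclp)
  qed blast
qed

fun push :: "nat \<Rightarrow> nat list \<Rightarrow> nat list" where
  "push x [] = (if x = 0 then [] else [x])"
| "push x (y # ys) = (if y = 0 \<and> ys \<noteq> [] then (x + hd ys) # tl ys else x # y # ys)"

definition norm_pos :: "nat list \<Rightarrow> nat list" where
  "norm_pos xs = dropWhile (\<lambda>s. s = 0) (foldr push xs [])"

lemma foldr_push_pos:
  "(\<forall>s\<in>set (tl (foldr push xs [])). 0 < s) \<and> foldr push xs [] \<noteq> [0]"
proof (induction xs)
  case (Cons x xs)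
  then show ?case
    by (cases "foldr push xs []") (auto simp: neq_Nil_conv split: if_splits)
qed simp

lemma push_combine:
  assumes "\<forall>s\<in>set (tl zs). 0 < s" "zs \<noteq> [0]"
  shows "push x (push 0 (push y zs)) = push (x + y) zs"
  using assms by (cases zs; cases "tl zs") auto

lemma norm_pos_identify: "identify xs ys \<Longrightarrow> norm_pos xs = norm_pos ys"
proof (induction rule: identify.induct)
  case (delete_first xs)
  then show ?case using foldr_push_pos[of xs]
    by (cases "foldr push xs []"; cases "tl (foldr push xs [])") (auto simp: norm_pos_def)
next
  case (delete_last xs)
  then show ?case by (simp add: norm_pos_def)
next
  case (combine xs x y ys)
  then show ?case using foldr_push_pos[of ys] by (simp add: norm_pos_def push_combine)
qed

lemma norm_pos_position:
  assumes "position p"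
  shows "norm_pos p = p"
proof -
  have "foldr push p [] = p"
    using assms
  proof (induction p)
    case (Cons x xs)
    then show ?case by (cases xs) (auto simp: position_def)
  qed simp
  then show ?thesis
    using assms by (cases p) (auto simp: norm_pos_def position_def)
qed

lemma ex1_position: "\<exists>!p. identify\<^sup>*\<^sup>* xs p \<and> position p"
proof -
  have "norm_pos xs = p" if "identify\<^sup>*\<^sup>* xs p" "position p" for p
    using that by (induction rule: converse_rtranclp_induct)
      (auto simp: norm_pos_position norm_pos_identify)
  then show ?thesis using ex_position by metis
qed

end

theory Submission
  imports Defs
begin

text \<open>
  Lay the tiles out in a row. A sequence of ones and twos lies in \<open>S\<close> exactly when the first tiles
  of all its stacks of size two occupy places of the same parity. This property survives every
  move, and a move between such positions removes one, two or four tiles, so the tile count modulo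
  three always changes. Conversely one or two tiles can be removed whenever there are as many.
\<close>

section \<open>Parity alignment of the stacks of size two\<close>

text \<open>The flag \<open>c\<close> tells whether a stack of size two may start at the next place.\<close>

fun aligned :: "bool \<Rightarrow> nat list \<Rightarrow> bool" where
  "aligned c [] = True"
| "aligned c (x # xs) = (x = 1 \<and> aligned (\<not> c) xs \<or> x = 2 \<and> c \<and> aligned c xs)"

text \<open>A one flips the flag and a two keeps it, so reading \<open>xs\<close> changes the flag
  by the parity of its tile count.\<close>

lemma aligned_append:
  "aligned c (xs @ ys) \<longleftrightarrow> aligned c xs \<and> aligned (c \<noteq> odd (sum_list xs)) ys"
  by (induction c xs rule: aligned.induct) auto

lemma aligned_replicate_1 [simp]: "aligned c (replicate m (Suc 0))"
  by (induction m arbitrary: c) auto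

lemma aligned_entries: "aligned c p \<Longrightarrow> s \<in> set p \<Longrightarrow> s = 1 \<or> s = 2"
  by (induction c p rule: aligned.induct) auto

lemma aligned_position: "aligned c p \<Longrightarrow> position p"
  using aligned_entries by (fastforce simp: position_def)

lemma interior_ones_Cons: "interior_ones xs m \<Longrightarrow> interior_ones (x # xs) m"
  unfolding interior_ones_def by (metis append_Cons last_ConsR list.discI)

text \<open>Ones before the first two may come in any number, so the flag is existential; between
  two successive twos their number is even, which keeps the parity of the starting places.\<close>

lemma S_aligned: "p \<in> S \<Longrightarrow> \<exists>c. aligned c p"
proof (induction p)
  case (Cons x xs)
  have "xs \<in> S"
    using Cons.prems interior_ones_Cons by (fastforce simp: S_def)
  then obtain c where c: "aligned c xs"
    using Cons.IH by blast
  consider "x = 1" | "x = 2"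
    using Cons.prems by (force simp: S_def)
  then show ?case
  proof cases
    case 1
    with c show ?thesis
      by (intro exI[of _ "\<not> c"]) simp
  next
    case 2
    define m where "m = length (takeWhile (\<lambda>s. s = 1) xs)"
    define ys where "ys = dropWhile (\<lambda>s. s = 1) xs"
    have "takeWhile (\<lambda>s. s = 1) xs = replicate m 1"
      unfolding m_def by (rule replicate_eqI) (auto dest: set_takeWhileD)
    then have xs: "xs = replicate m 1 @ ys"
      unfolding ys_def by (metis takeWhile_dropWhile_id)
    \<comment> \<open>The leading two forces the flag to be \<open>True\<close>. If
      \<open>ys\<close> is nonempty, it starts with a two, and the ones before it form an interior
      block (or \<open>m = 0\<close>). Hence \<open>m\<close> is even, \<open>ys\<close> is read
      with the flag \<open>c\<close>, and its first two makes \<open>c\<close> true.\<close>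
    have "aligned True xs"
    proof (cases "ys = []")
      case False
      then have hd: "hd ys \<noteq> 1"
        unfolding ys_def by (rule hd_dropWhile)
      have "interior_ones (x # xs) m" if "m \<ge> 1"
        unfolding interior_ones_def using that False hd 2 xs
        by (intro conjI exI[where x = "[x]"] exI[where x = ys]) simp_all
      then have "even m"
        using Cons.prems by (cases "m = 0") (auto simp: S_def)
      moreover have "aligned (c \<noteq> odd m) ys"
        using c by (simp add: xs aligned_append sum_list_replicate)
      ultimately show ?thesis
        using False hd by (cases ys) (auto simp: xs aligned_append sum_list_replicate)
    qed (simp add: xs)
    with 2 show ?thesis
      by (intro exI[of _ True]) simp
  qed
qed simp

section \<open>Moves preserve alignment\<close>

lemma identify_two_zeros: "identify\<^sup>*\<^sup>* (xs @ 0 # 0 # ys) (xs @ ys)"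
proof (cases xs rule: rev_cases)
  case Nil
  then show ?thesis
    using delete_first by simp (meson converse_rtranclp_into_rtranclp rtranclp.rtrancl_refl)
next
  case (snoc xs' x)
  then show ?thesis
    \<comment> \<open>The second zero acts as the right neighbor of the first, so one combination
      removes both.\<close>
    using combine[of xs' x 0 ys] by auto
qed

text \<open>Removal from the first stack at most shifts all places together, which the free flag
  \<open>c'\<close> absorbs. Removal from two consecutive stacks takes an even number of tiles, so
  later places keep their parity. A merge never yields a stack above two, because alignment forces
  the neighbor that is merged to be a one.\<close>

lemma remove_tiles_aligned:
  assumes "aligned c p" "remove_tiles p r"
  shows "\<exists>q c'. identify\<^sup>*\<^sup>* r q \<and> aligned c' q"
  using assms(2,1)
proof cases
  case (from_first k s xs)
  then have "k \<in> {1, 2}" "s \<in> {1, 2}"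
    using assms(1) by auto
  with from_first(3,4) consider "s = k" | "s = 2" "k = 1"
    by auto
  then show ?thesis
  proof cases
    case 1
    have "identify r xs"
      using 1 from_first by (simp add: delete_first)
    moreover obtain c' where "aligned c' xs"
      using assms(1) from_first by auto
    ultimately show ?thesis by blast
  next
    case 2
    then have "aligned (\<not> c) r"
      using assms(1) from_first by auto
    then show ?thesis by blast
  qed
next
  case (from_last k s xs)
  then have "k \<in> {1, 2}" "s \<in> {1, 2}"
    using assms(1) by (auto simp: aligned_append)
  with from_last(3,4) consider "s = k" | "s = 2" "k = 1"
    by auto
  then show ?thesis
  proof cases
    case 1
    have "identify r xs"
      using 1 from_last by (simp add: delete_last)
    moreover have "aligned c xs"
      using assms(1) from_last by (simp add: aligned_append)
    ultimately show ?thesis by blast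
  next
    case 2
    then have "aligned c r"
      using assms(1) from_last by (auto simp: aligned_append)
    then show ?thesis by blast
  qed
next
  case (from_consecutive k s t xs ys)
  have al: "aligned c (xs @ s # t # ys)"
    using assms(1) from_consecutive(1) by simp
  then have "k \<in> {1, 2}" "s \<in> {1, 2}" "t \<in> {1, 2}"
    using from_consecutive(3-5) by (auto simp: aligned_append)
  with from_consecutive(4,5) consider "s = k" "t = k" "s = 1 \<or> s = 2"
    | "s = 2" "t = 2" "k = 1" | "s = 1" "t = 2" "k = 1" | "s = 2" "t = 1" "k = 1"
    by (elim insertE emptyE) simp_all
  then show ?thesis
  proof cases
    case 1
    have "identify\<^sup>*\<^sup>* r (xs @ ys)"
      using 1 from_consecutive(2) by (simp add: identify_two_zeros)
    moreover have "aligned c (xs @ ys)"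
      using 1 al by (cases c; elim disjE) (auto simp: aligned_append)
    ultimately show ?thesis by blast
  next
    case 2
    have "aligned c r"
      using al 2 from_consecutive(2) by (auto simp: aligned_append)
    then show ?thesis by blast
  next
    case 3
    then have r: "r = xs @ 0 # 1 # ys"
      using from_consecutive by simp
    show ?thesis
    proof (cases xs rule: rev_cases)
      case Nil
      have "identify r (1 # ys)"
        using r Nil by (simp add: delete_first)
      moreover have "aligned c (1 # ys)"
        using 3 Nil al by auto
      ultimately show ?thesis by blast
    next
      case (snoc xs' x)
      \<comment> \<open>If \<open>x\<close> were a two, it would start three places before the two
        \<open>t\<close>. So \<open>x = 1\<close>, and the merged two starts two places before
        \<open>t\<close>.\<close>
      have "x = 1 \<and> aligned c (xs' @ 2 # ys)"
        using 3 snoc al by (cases c; auto simp: aligned_append)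
      moreover have "identify r (xs' @ (x + 1) # ys)"
        using r snoc combine[of xs' x 1 ys] by simp
      ultimately show ?thesis by (auto simp: numeral_2_eq_2)
    qed
  next
    case 4
    then have r: "r = xs @ 1 # 0 # ys"
      using from_consecutive by simp
    show ?thesis
    proof (cases ys)
      case Nil
      have "identify r (xs @ [1])"
        using r Nil delete_last[of "xs @ [1]"] by simp
      moreover have "aligned c (xs @ [1])"
        using al by (simp add: aligned_append)
      ultimately show ?thesis by blast
    next
      case (Cons y ys')
      \<comment> \<open>If \<open>y\<close> were a two, it would start three places after the two
        \<open>s\<close>. So \<open>y = 1\<close>, and the merged two starts where \<open>s\<close>
        did.\<close>
      have "y = 1 \<and> aligned c (xs @ 2 # ys')"
        using 4 Cons al by (cases c; auto simp: aligned_append)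
      moreover have "identify r (xs @ (1 + y) # ys')"
        using r Cons combine[of xs 1 y ys'] by simp
      ultimately show ?thesis by (auto simp: numeral_2_eq_2)
    qed
  qed
qed

text \<open>Aligned sequences are positions, so uniqueness of the reduced form identifies
  \<open>q\<close> with the aligned reduct of \<open>r\<close>.\<close>

lemma move_aligned:
  assumes "aligned c p" "move p q"
  shows "\<exists>c'. aligned c' q"
proof -
  obtain r where r: "remove_tiles p r" "identify\<^sup>*\<^sup>* r q" "position q"
    using assms(2) by (auto simp: move_def)
  obtain q' c' where q': "identify\<^sup>*\<^sup>* r q'" "aligned c' q'"
    using remove_tiles_aligned[OF assms(1) r(1)] by blast
  then have "q = q'"
    using r ex1_position[of r] aligned_position by blast
  with q' show ?thesis by blast
qed

section \<open>Tile counts and outcomes\<close>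

lemma identify_sum_list: "identify\<^sup>*\<^sup>* r q \<Longrightarrow> sum_list q = sum_list r"
proof (induction rule: rtranclp_induct)
  case (step q q')
  from step(2) have "sum_list q' = sum_list q"
    by cases auto
  with step show ?case by simp
qed simp

text \<open>Stacks hold at most two tiles, so \<open>k\<close> is 1 or 2: an end move takes
  \<open>k\<close> tiles and a consecutive move \<open>2 * k\<close>, never a multiple of
  three.\<close>

lemma remove_tiles_sum_list:
  assumes "aligned c p" "remove_tiles p r"
  shows "\<exists>d\<in>{1, 2, 4}. sum_list p = sum_list r + d"
  using assms(2)
proof cases
  case (from_first k s xs)
  then have "k \<in> {1, 2}" using assms(1) by auto
  with from_first show ?thesis by auto
next
  case (from_last k s xs)
  then have "k \<in> {1, 2}" using assms(1) by (auto simp: aligned_append)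
  with from_last show ?thesis by auto
next
  case (from_consecutive k s t xs ys)
  then have "k \<in> {1, 2}" using assms(1) by (auto simp: aligned_append)
  with from_consecutive show ?thesis by auto
qed

lemma move_sum_list:
  assumes "aligned c p" "move p q"
  shows "\<exists>d\<in>{1, 2, 4}. sum_list p = sum_list q + d"
  using assms remove_tiles_sum_list identify_sum_list unfolding move_def by metis

lemma ex_move_sum_list:
  assumes "aligned c p" "d \<in> {1, 2}" "d \<le> sum_list p"
  shows "\<exists>q. move p q \<and> sum_list p = sum_list q + d"
proof -
  obtain r where r: "remove_tiles p r" "sum_list p = sum_list r + d"
  proof (cases p)
    case Nil
    then show ?thesis using assms by auto
  next
    case (Cons x xs)
    show ?thesis
    proof (cases "d \<le> x")
      case True
      then show ?thesis
        using that[of "(x - d) # xs"] from_first[of d x xs] assms(2) Cons by auto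
    next
      case False
      \<comment> \<open>The first stack is too small only when two tiles are wanted from a one; then
        one tile is taken from each of the first two stacks.\<close>
      then have "d = 2" "x = 1"
        using assms Cons by auto
      then obtain y ys where "xs = y # ys" "1 \<le> y"
        using assms Cons by (cases xs) auto
      then show ?thesis
        using that[of "(x - 1) # (y - 1) # ys"] from_consecutive[of 1 x y "[]" ys] Cons
          \<open>d = 2\<close> \<open>x = 1\<close> by auto
    qed
  qed
  obtain q where "identify\<^sup>*\<^sup>* r q" "position q"
    using ex_position by blast
  then show ?thesis
    using r assms(1) identify_sum_list aligned_position unfolding move_def by metis
qed

lemma aligned_outcome:
  assumes "aligned c p"
  shows "if sum_list p mod 3 = 0 then P_position p else N_position p"
  using assms
proof (induction "sum_list p" arbitrary: c p rule: less_induct)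
  case less
  note outcome = less.hyps
  show ?case
  proof (cases "sum_list p mod 3 = 0")
    case True
    have "N_position q" if q: "move p q" for q
    proof -
      obtain d where d: "d \<in> {1, 2, 4}" "sum_list p = sum_list q + d"
        using move_sum_list[OF less.prems q] by blast
      then have "d = 1 \<or> d = 2 \<or> d = 4" by simp
      with d(2) True have "sum_list q < sum_list p" "sum_list q mod 3 \<noteq> 0"
        by presburger+
      then show ?thesis
        using outcome move_aligned[OF less.prems q] by metis
    qed
    then show ?thesis
      using True P aligned_position[OF less.prems] by simp
  next
    case False
    then have "sum_list p mod 3 \<in> {1, 2}" by auto
    \<comment> \<open>The residue itself is the number of tiles to remove, which leaves a multiple
      of three.\<close>
    then obtain q where q: "move p q" "sum_list p = sum_list q + sum_list p mod 3"
      using ex_move_sum_list[OF less.prems] mod_less_eq_dividend by blast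
    then have "sum_list q < sum_list p" "sum_list q mod 3 = 0"
      using False by presburger+
    then show ?thesis
      using False N[OF q(1)] outcome move_aligned[OF less.prems q(1)] by metis
  qed
qed

theorem theorem19:
  fixes k :: nat
  shows "(k mod 3 = 0 \<longrightarrow> (\<forall>p\<in>S_sum k. P_position p)) \<and>
         (k mod 3 \<noteq> 0 \<longrightarrow> (\<forall>p\<in>S_sum k. N_position p))"
proof -
  have "if k mod 3 = 0 then P_position p else N_position p" if "p \<in> S_sum k" for p
    using that S_aligned[of p] aligned_outcome[of _ p] by (auto simp: S_sum_def)
  then show ?thesis by (simp split: if_splits)
qed

end
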